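(* Let $K>0$ and let $f,g\in L^1(\tau)$ satisfy $\|f\|_{L^1(\tau)}\le K$ and $\|g\|_{L^1(\tau)}\le K$. Then: - for every $p\in\,]1,2]$, $$D_{\bar\eta_p}(f,g)\ge\frac{K^{p-2}}{2}\|f-g\|_{L^1(\tau)}^2;$$ - if moreover $f,g\ge0$, the inequality also holds for $\eta_{\mathrm{ent}}$ with $p=1$, i.e. $D_{\bar\eta_{\mathrm{ent}}}(f,g)\ge\frac{K^{-1}}{2}\|f-g\|_{L^1(\tau)}^2$; - for $\eta_{\mathrm{hyp}}$ with parameter $\beta>0$, $$D_{\bar\eta_{\mathrm{hyp}}}(f,g)\ge\frac{(K+\beta)^{-1}}{2}\|f-g\|_{L^1(\tau)}^2.$$
   Context: $\Theta$ is a compact Riemannian manifold without boundary and $\tau$ is the probability measure on $\Theta$ proportional to the volume measure. For a convex function $\eta$, differentiable in the interior of its domain, $D_\eta(a,b)=\eta(a)-\eta(b)-\eta'(b)(a-b)$ and $D_{\bar\eta}(f,g)=\int_\Theta D_\eta(f(\theta),g(\theta))\,\mathrm{d}\tau(\theta)\in[0,+\infty]$. Power functions: $\eta_p(u)=\frac{|u|^p}{p(p-1)}$ on $\mathbb{R}$, for $p>1$. Shannon entropy: $\eta_{\mathrm{ent}}(u)=u\log u-u+1$ on $[0,+\infty[$ (with $0\log0=0$); here $\eta_{\mathrm{ent}}'(0)=-\infty$, and $D_{\eta_{\mathrm{ent}}}(a,0)$ is $+\infty$ for $a>0$ and $0$ for $a=0$. Hyperbolic entropy with parameter $\beta>0$: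 $\eta_{\mathrm{hyp}}(u)=u\,\mathrm{arcsinh}(u/\beta)-\sqrt{u^2+\beta^2}+\beta$ on $\mathbb{R}$. *)

theory Defs
  imports "HOL-Probability.Probability"
begin

section \<open>Smooth manifolds\<close>

text \<open>These notions are meant for open \<open>S\<close> in a finite-dimensional space; there, continuity of
  all iterated directional derivatives is the same as continuity of all iterated Frechet
  derivatives.\<close>

fun Ck_on :: "nat \<Rightarrow> 'a::real_normed_vector set \<Rightarrow> ('a \<Rightarrow> 'b::real_normed_vector) \<Rightarrow> bool" where
  "Ck_on 0 S f \<longleftrightarrow> continuous_on S f"
| "Ck_on (Suc k) S f \<longleftrightarrow>
     (\<forall>x\<in>S. f differentiable (at x)) \<and>
     (\<forall>v. Ck_on k S (\<lambda>x. frechet_derivative f (at x) v))"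

definition smooth_on :: "'a::real_normed_vector set \<Rightarrow> ('a \<Rightarrow> 'b::real_normed_vector) \<Rightarrow> bool" where
  "smooth_on S f \<longleftrightarrow> (\<forall>k. Ck_on k S f)"

text \<open>A chart is a pair of its domain and its coordinate map; the values of the map outside the
  domain are irrelevant. The image is open in the whole Euclidean space (not in a half space), so
  the manifolds below have no boundary.\<close>

type_synonym ('a, 'n) chart = "'a set \<times> ('a \<Rightarrow> real ^ 'n)"

definition chart_image :: "('a, 'n::finite) chart \<Rightarrow> (real ^ 'n) set" where
  "chart_image c = snd c ` fst c"

definition chart_inv :: "('a, 'n::finite) chart \<Rightarrow> real ^ 'n \<Rightarrow> 'a" where
  "chart_inv c = inv_into (fst c) (snd c)"

definition is_chart :: "'a::t2_space set \<Rightarrow> ('a, 'n::finite) chart \<Rightarrow> bool" where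
  "is_chart M c \<longleftrightarrow>
     openin (top_of_set M) (fst c) \<and>
     open (chart_image c) \<and>
     homeomorphism (fst c) (chart_image c) (snd c) (chart_inv c)"

definition transition :: "('a, 'n::finite) chart \<Rightarrow> ('a, 'n) chart \<Rightarrow> real ^ 'n \<Rightarrow> real ^ 'n" where
  "transition c d = snd d \<circ> chart_inv c"

definition smooth_atlas :: "'a::t2_space set \<Rightarrow> ('a, 'n::finite) chart set \<Rightarrow> bool" where
  "smooth_atlas M \<A> \<longleftrightarrow>
     (\<forall>c\<in>\<A>. is_chart M c) \<and>
     (\<Union>c\<in>\<A>. fst c) = M \<and>
     (\<forall>c\<in>\<A>. \<forall>d\<in>\<A>. smooth_on (snd c ` (fst c \<inter> fst d)) (transition c d))"

section \<open>Riemannian metrics and their volume measure\<close>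

text \<open>A Riemannian metric is given by its coordinate expressions: \<open>g c x\<close> is the inner product
  on tangent vectors at the point with coordinates \<open>x\<close> in the chart \<open>c\<close>, tangent vectors being
  written in the coordinate basis of \<open>c\<close>. The last clause is the transformation law of a
  covariant 2-tensor.\<close>

type_synonym ('a, 'n) metric_tensor =
  "('a, 'n) chart \<Rightarrow> real ^ 'n \<Rightarrow> real ^ 'n \<Rightarrow> real ^ 'n \<Rightarrow> real"

definition riemannian_metric ::
  "('a, 'n::finite) chart set \<Rightarrow> ('a, 'n) metric_tensor \<Rightarrow> bool" where
  "riemannian_metric \<A> g \<longleftrightarrow>
     (\<forall>c\<in>\<A>. \<forall>x\<in>chart_image c.
        bilinear (g c x) \<and>
        (\<forall>v w. g c x v w = g c x w v) \<and>
        (\<forall>v. v \<noteq> 0 \<longrightarrow> g c x v v > 0)) \<and>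
     (\<forall>c\<in>\<A>. \<forall>v w. smooth_on (chart_image c) (\<lambda>x. g c x v w)) \<and>
     (\<forall>c\<in>\<A>. \<forall>d\<in>\<A>. \<forall>\<theta>\<in>fst c \<inter> fst d. \<forall>v w.
        g c (snd c \<theta>) v w =
        g d (snd d \<theta>) (frechet_derivative (transition c d) (at (snd c \<theta>)) v)
                      (frechet_derivative (transition c d) (at (snd c \<theta>)) w))"

definition compact_riemannian_manifold ::
  "'a::t2_space set \<Rightarrow> ('a, 'n::finite) chart set \<Rightarrow> ('a, 'n) metric_tensor \<Rightarrow> bool" where
  "compact_riemannian_manifold M \<A> g \<longleftrightarrow>
     compact M \<and> smooth_atlas M \<A> \<and> riemannian_metric \<A> g"

definition volume_density ::
  "('a, 'n::finite) metric_tensor \<Rightarrow> ('a, 'n) chart \<Rightarrow> real ^ 'n \<Rightarrow> real" where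
  "volume_density g c x = sqrt (det (\<chi> i j. g c x (axis i 1) (axis j 1)))"

text \<open>The volume measure is the Borel measure on \<open>M\<close> that has density \<open>sqrt (det g)\<close> with respect to
  Lebesgue measure in every chart. The charts cover \<open>M\<close>, finitely many of them suffice by
  compactness, so this determines it.\<close>

definition riemannian_volume ::
  "'a::t2_space set \<Rightarrow> ('a, 'n::finite) chart set \<Rightarrow> ('a, 'n) metric_tensor \<Rightarrow> 'a measure \<Rightarrow> bool" where
  "riemannian_volume M \<A> g vol \<longleftrightarrow>
     sets vol = sets (restrict_space borel M) \<and>
     (\<forall>c\<in>\<A>. \<forall>B\<in>sets vol. B \<subseteq> fst c \<longrightarrow>
        emeasure vol B = (\<integral>\<^sup>+x\<in>snd c ` B. ennreal (volume_density g c x) \<partial>lborel))"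

definition normalized_volume ::
  "'a::t2_space set \<Rightarrow> ('a, 'n::finite) chart set \<Rightarrow> ('a, 'n) metric_tensor \<Rightarrow> 'a measure \<Rightarrow> bool" where
  "normalized_volume M \<A> g \<tau> \<longleftrightarrow>
     prob_space \<tau> \<and>
     (\<exists>vol r. riemannian_volume M \<A> g vol \<and> 0 < r \<and> \<tau> = scale_measure (ennreal r) vol)"

section \<open>Bregman divergences\<close>

text \<open>The derivative of \<open>\<eta>\<close>, whose domain is \<open>I\<close>, with values in the extended reals. At an endpoint
  of \<open>I\<close> this is the one-sided derivative, which may be infinite.\<close>

definition ext_deriv :: "real set \<Rightarrow> (real \<Rightarrow> real) \<Rightarrow> real \<Rightarrow> ereal" where
  "ext_deriv I \<eta> b = Lim (at b within I) (\<lambda>u. ereal ((\<eta> u - \<eta> b) / (u - b)))"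

text \<open>At \<open>b\<close> with \<open>ext_deriv I \<eta> b = - \<infinity>\<close> the arithmetic of \<^typ>\<open>ereal\<close> (with \<open>- \<infinity> * 0 = 0\<close>) yields
  \<open>\<infinity>\<close> for \<open>a > b\<close> and \<open>0\<close> for \<open>a = b\<close>.\<close>

definition bregman :: "real set \<Rightarrow> (real \<Rightarrow> real) \<Rightarrow> real \<Rightarrow> real \<Rightarrow> ereal" where
  "bregman I \<eta> a b = ereal (\<eta> a - \<eta> b) - ext_deriv I \<eta> b * ereal (a - b)"

text \<open>For convex \<open>\<eta>\<close> the integrand is nonnegative, so \<^const>\<open>e2ennreal\<close> truncates nothing.\<close>

definition bregman_int ::
  "'a measure \<Rightarrow> real set \<Rightarrow> (real \<Rightarrow> real) \<Rightarrow> ('a \<Rightarrow> real) \<Rightarrow> ('a \<Rightarrow> real) \<Rightarrow> ennreal" where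
  "bregman_int \<tau> I \<eta> f g = (\<integral>\<^sup>+\<theta>. e2ennreal (bregman I \<eta> (f \<theta>) (g \<theta>)) \<partial>\<tau>)"

definition eta_pow :: "real \<Rightarrow> real \<Rightarrow> real" where
  "eta_pow p u = \<bar>u\<bar> powr p / (p * (p - 1))"

definition eta_ent :: "real \<Rightarrow> real" where
  "eta_ent u = u * ln u - u + 1"

definition eta_hyp :: "real \<Rightarrow> real \<Rightarrow> real" where
  "eta_hyp \<beta> u = u * arsinh (u / \<beta>) - sqrt (u\<^sup>2 + \<beta>\<^sup>2) + \<beta>"

definition L1_norm :: "'a measure \<Rightarrow> ('a \<Rightarrow> real) \<Rightarrow> real" where
  "L1_norm \<tau> f = (\<integral>\<theta>. \<bar>f \<theta>\<bar> \<partial>\<tau>)"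

end

theory Submission
  imports Defs
begin

text \<open>In all three cases \<open>1 / \<eta>'' u \<le> \<alpha> + \<gamma> * \<bar>u\<bar>\<close> with \<open>\<alpha> + \<gamma> * K = C\<close>, where \<open>1 / (2 * C)\<close> is
  the constant of the inequality: for \<open>\<eta>\<^sub>p\<close> the right-hand side is the tangent at \<open>K\<close> to the
  concave function \<open>u powr (2 - p)\<close>. The Taylor formula along the segment from \<open>b\<close> to \<open>a\<close>, together
  with \<open>\<eta>'' * x\<^sup>2 \<ge> 2 * \<mu> * \<bar>x\<bar> - \<mu>\<^sup>2 / \<eta>''\<close> for \<open>x = a - b\<close>, gives the pointwise bound
  \<open>D a b \<ge> \<mu> * \<bar>a - b\<bar> - \<mu>\<^sup>2 * (\<alpha> / 2 + \<gamma> * (\<bar>b\<bar> / 3 + \<bar>a\<bar> / 6))\<close>. Integrating yields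
  \<open>\<mu> * N - \<mu>\<^sup>2 * C / 2\<close> with \<open>N\<close> the \<open>L\<^sup>1\<close> distance, and \<open>\<mu> = N / C\<close> is optimal. This replaces
  the Cauchy-Schwarz inequality and needs no exchange of integrals.\<close>

section \<open>Taylor lower bound along a segment\<close>

text \<open>The exceptional point \<open>c\<close> is needed because the derivative of
  \<open>eta_pow p\<close> is not differentiable at 0 when \<open>p < 2\<close>, and a segment may
  cross 0. Continuity glues the monotone pieces on the two sides of \<open>c\<close>.\<close>

lemma DERIV_nonneg_imp_increasing_except:
  fixes F :: "real \<Rightarrow> real"
  assumes "u \<le> v" and cont: "continuous_on {u..v} F"
    and deriv: "\<And>t. u < t \<Longrightarrow> t < v \<Longrightarrow> t \<noteq> c \<Longrightarrow> \<exists>D. DERIV F t :> D \<and> D \<ge> 0"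
  shows "F u \<le> F v"
proof -
  have *: "F r \<le> F s" if "u \<le> r" "r \<le> s" "s \<le> v" "c \<notin> {r<..<s}" for r s
  proof (rule DERIV_nonneg_imp_increasing_open[of r s F])
    show "r \<le> s" by fact
    show "continuous_on {r..s} F"
      by (rule continuous_on_subset[OF cont]) (use that in auto)
    show "\<exists>D. DERIV F t :> D \<and> D \<ge> 0" if "r < t" "t < s" for t
      using that \<open>c \<notin> {r<..<s}\<close> \<open>u \<le> r\<close> \<open>s \<le> v\<close> by (intro deriv) auto
  qed
  show ?thesis
  proof (cases "u < c \<and> c < v")
    case True
    then show ?thesis using *[of u c] *[of c v] by auto
  qed (use * assms in auto)
qed

text \<open>The weights come from the Taylor kernel \<open>1 - t\<close> on [0,1]: its integral is
  1/2, and its integrals against \<open>1 - t\<close> and \<open>t\<close>, the coefficients of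
  \<open>\<bar>b\<bar>\<close> and \<open>\<bar>a\<bar>\<close> in the bound for a point of the
  segment, are 1/3 and 1/6.\<close>

lemma bregman_pointwise_bound:
  fixes I :: "real set" and \<eta> \<eta>' \<eta>'' :: "real \<Rightarrow> real"
  assumes "convex I" and aI: "a \<in> I" and bI: "b \<in> I" and ge0: "\<alpha> \<ge> 0" "\<gamma> \<ge> 0"
    and d1: "\<And>u. u \<in> I \<Longrightarrow> DERIV \<eta> u :> \<eta>' u"
    and c1: "continuous_on I \<eta>'"
    and d2: "\<And>u. u \<in> I \<Longrightarrow> u \<noteq> 0 \<Longrightarrow> DERIV \<eta>' u :> \<eta>'' u"
    and pos: "\<And>u. u \<in> I \<Longrightarrow> u \<noteq> 0 \<Longrightarrow> \<alpha> + \<gamma> * \<bar>u\<bar> > 0"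
    and lb: "\<And>u. u \<in> I \<Longrightarrow> u \<noteq> 0 \<Longrightarrow> \<eta>'' u \<ge> 1 / (\<alpha> + \<gamma> * \<bar>u\<bar>)"
  shows "\<mu> * \<bar>a - b\<bar> - \<mu>\<^sup>2 * (\<alpha> / 2 + \<gamma> * (\<bar>b\<bar> / 3 + \<bar>a\<bar> / 6)) \<le> \<eta> a - \<eta> b - \<eta>' b * (a - b)"
proof (cases "a = b")
  case True
  then show ?thesis using ge0 by simp
next
  case False
  define x where "x = a - b"
  have x0: "x \<noteq> 0" using False by (simp add: x_def)
  define h where "h t = b + t * x" for t
  have hI: "h t \<in> I" if "0 \<le> t" "t \<le> 1" for t
    using convexD_alt[OF \<open>convex I\<close> bI aI, of t] that by (simp add: h_def x_def algebra_simps)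
  \<comment> \<open>The polynomial added to \<open>\<eta> (h t)\<close> vanishes at 0 together with
    its derivative, and its second derivative is the one that makes \<open>G''\<close> nonnegative.
    Hence \<open>G' 0 = \<eta>' b * x\<close>, and the claim reads
    \<open>G' 0 \<le> G 1 - G 0\<close>.\<close>
  define G where "G t = \<eta> (h t) - \<mu> * \<bar>x\<bar> * t\<^sup>2
    + \<mu>\<^sup>2 * (\<alpha> * t\<^sup>2 / 2 + \<gamma> * (\<bar>b\<bar> * (t\<^sup>2 / 2 - t ^ 3 / 6) + \<bar>a\<bar> * t ^ 3 / 6))" for t
  define G' where "G' t = \<eta>' (h t) * x - 2 * \<mu> * \<bar>x\<bar> * t
    + \<mu>\<^sup>2 * (\<alpha> * t + \<gamma> * (\<bar>b\<bar> * (t - t\<^sup>2 / 2) + \<bar>a\<bar> * t\<^sup>2 / 2))" for t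
  define G'' where "G'' t = \<eta>'' (h t) * x\<^sup>2 - 2 * \<mu> * \<bar>x\<bar>
    + \<mu>\<^sup>2 * (\<alpha> + \<gamma> * (\<bar>b\<bar> * (1 - t) + \<bar>a\<bar> * t))" for t
  have dh: "DERIV h t :> x" for t
    unfolding h_def by (auto intro!: derivative_eq_intros)
  have dG: "DERIV G t :> G' t" if "0 \<le> t" "t \<le> 1" for t
  proof -
    have "DERIV (\<lambda>t. \<eta> (h t)) t :> \<eta>' (h t) * x"
      by (rule DERIV_chain2[where g = h, OF d1[OF hI[OF that]] dh])
    then show ?thesis
      unfolding G_def G'_def
      by (auto intro!: derivative_eq_intros simp: field_simps power2_eq_square)
  qed
  have dG': "DERIV G' t :> G'' t" if "0 \<le> t" "t \<le> 1" "h t \<noteq> 0" for t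
  proof -
    have "DERIV (\<lambda>t. \<eta>' (h t)) t :> \<eta>'' (h t) * x"
      by (rule DERIV_chain2[where g = h, OF d2[OF hI[OF that(1,2)] that(3)] dh])
    then show ?thesis
      unfolding G'_def G''_def
      by (auto intro!: derivative_eq_intros simp: field_simps power2_eq_square)
  qed
  have cG': "continuous_on {0..1} G'"
  proof -
    have "continuous_on {0..1} (\<lambda>t. \<eta>' (h t))"
    proof (rule continuous_on_compose2[OF c1])
      show "continuous_on {0..1} h" unfolding h_def by (intro continuous_intros)
    qed (auto simp: hI)
    then show ?thesis unfolding G'_def by (intro continuous_intros) auto
  qed
  have G''0: "G'' t \<ge> 0" if "0 \<le> t" "t \<le> 1" "h t \<noteq> 0" for t
  proof -
    define \<phi> where "\<phi> = \<alpha> + \<gamma> * \<bar>h t\<bar>"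
    have \<phi>: "\<phi> > 0" "\<eta>'' (h t) \<ge> 1 / \<phi>"
      unfolding \<phi>_def using pos lb hI that by auto
    have "h t = (1 - t) * b + t * a" by (simp add: h_def x_def algebra_simps)
    then have "\<bar>h t\<bar> \<le> \<bar>(1 - t) * b\<bar> + \<bar>t * a\<bar>" by (metis abs_triangle_ineq)
    also have "\<dots> = \<bar>b\<bar> * (1 - t) + \<bar>a\<bar> * t" using that by (simp add: abs_mult)
    finally have "\<phi> \<le> \<alpha> + \<gamma> * (\<bar>b\<bar> * (1 - t) + \<bar>a\<bar> * t)"
      unfolding \<phi>_def using ge0 by (simp add: mult_left_mono)
    then have 1: "\<mu>\<^sup>2 * \<phi> \<le> \<mu>\<^sup>2 * (\<alpha> + \<gamma> * (\<bar>b\<bar> * (1 - t) + \<bar>a\<bar> * t))"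
      by (intro mult_left_mono) auto
    have 2: "1 / \<phi> * x\<^sup>2 \<le> \<eta>'' (h t) * x\<^sup>2"
      using \<phi> by (intro mult_right_mono) auto
    \<comment> \<open>Completing the square with \<open>1 / \<phi>\<close> in place of the second
      derivative, which is at least as large.\<close>
    have "0 \<le> (\<bar>x\<bar> - \<mu> * \<phi>)\<^sup>2 / \<phi>" using \<phi> by simp
    also have "\<dots> = 1 / \<phi> * x\<^sup>2 - 2 * \<mu> * \<bar>x\<bar> + \<mu>\<^sup>2 * \<phi>"
      using \<phi> by (simp add: field_simps power2_eq_square)
    finally show ?thesis unfolding G''_def using 1 2 by linarith
  qed
  have mono: "G' 0 \<le> G' z" if "0 \<le> z" "z \<le> 1" for z
  \<comment> \<open>The parameter \<open>- b / x\<close> is the only one at which \<open>h\<close>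
    vanishes; it may lie outside [0,1].\<close>
  proof (rule DERIV_nonneg_imp_increasing_except[where F = G' and c = "- b / x"])
    show "0 \<le> z" by fact
    show "continuous_on {0..z} G'"
      by (rule continuous_on_subset[OF cG']) (use that in auto)
    fix t assume "0 < t" "t < z" "t \<noteq> - b / x"
    moreover from this have "h t \<noteq> 0" using x0 by (auto simp: h_def field_simps)
    ultimately show "\<exists>D. DERIV G' t :> D \<and> D \<ge> 0"
      using dG'[of t] G''0[of t] that by auto
  qed
  \<comment> \<open>The mean value theorem for \<open>G\<close> and the monotonicity of
    \<open>G'\<close> take the place of an integral remainder.\<close>
  obtain z where "0 < z" "z < 1" "G 1 - G 0 = (1 - 0) * G' z"
    using MVT2[of 0 1 G G'] dG by auto
  then have "G' 0 \<le> G 1 - G 0" using mono[of z] by simp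
  then show ?thesis
    by (simp add: G_def G'_def h_def x_def algebra_simps)
qed

section \<open>From pointwise bounds to integrals\<close>

lemma ext_deriv_DERIV:
  assumes "DERIV \<eta> b :> d" and "b \<in> interior I"
  shows "ext_deriv I \<eta> b = ereal d"
proof -
  have "((\<lambda>u. ereal ((\<eta> u - \<eta> b) / (u - b))) \<longlongrightarrow> ereal d) (at b)"
    using assms(1) by (intro tendsto_ereal) (simp add: has_field_derivative_iff)
  then show ?thesis
    unfolding ext_deriv_def at_within_interior[OF assms(2)] by (intro tendsto_Lim) auto
qed

lemma bregman_DERIV:
  assumes "DERIV \<eta> b :> d" and "b \<in> interior I"
  shows "bregman I \<eta> a b = ereal (\<eta> a - \<eta> b - d * (a - b))"
  by (simp add: bregman_def ext_deriv_DERIV[OF assms])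

text \<open>The pointwise bound is assumed for every constant \<open>\<mu>\<close>, since the best
  one depends on the distance of \<open>f\<close> and \<open>g\<close> and can be chosen only when
  integrating.\<close>

lemma bregman_int_lower_bound:
  assumes int: "integrable \<tau> f" "integrable \<tau> g" and "prob_space \<tau>"
    and norm: "L1_norm \<tau> f \<le> K" "L1_norm \<tau> g \<le> K"
    and ge0: "\<gamma> \<ge> 0" and C: "\<alpha> + \<gamma> * K = C" "C > 0"
    and pointwise: "\<And>\<mu>. AE \<theta> in \<tau>. ereal (\<mu> * \<bar>f \<theta> - g \<theta>\<bar>
        - \<mu>\<^sup>2 * (\<alpha> / 2 + \<gamma> * (\<bar>g \<theta>\<bar> / 3 + \<bar>f \<theta>\<bar> / 6))) \<le> bregman I \<eta> (f \<theta>) (g \<theta>)"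
  shows "ennreal (1 / C / 2 * (L1_norm \<tau> (\<lambda>\<theta>. f \<theta> - g \<theta>))\<^sup>2) \<le> bregman_int \<tau> I \<eta> f g"
proof -
  interpret prob_space \<tau> by fact
  define N where "N = L1_norm \<tau> (\<lambda>\<theta>. f \<theta> - g \<theta>)"
  define \<mu> where "\<mu> = N / C"
  define R where "R \<theta> = \<mu> * \<bar>f \<theta> - g \<theta>\<bar>
    - \<mu>\<^sup>2 * (\<alpha> / 2 + \<gamma> * (\<bar>g \<theta>\<bar> / 3 + \<bar>f \<theta>\<bar> / 6))" for \<theta>
  have intR: "integrable \<tau> R"
    unfolding R_def using int by auto
  have "(\<integral>\<theta>. R \<theta> \<partial>\<tau>) = \<mu> * N
      - \<mu>\<^sup>2 * (\<alpha> / 2 + \<gamma> * (L1_norm \<tau> g / 3 + L1_norm \<tau> f / 6))"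
    unfolding R_def N_def L1_norm_def using int by (simp add: prob_space)
  moreover have "\<alpha> / 2 + \<gamma> * (L1_norm \<tau> g / 3 + L1_norm \<tau> f / 6) \<le> C / 2"
  proof -
    \<comment> \<open>The unequal weights do no harm: both norms are at most \<open>K\<close>, and
      1/3 + 1/6 = 1/2.\<close>
    have "L1_norm \<tau> g / 3 + L1_norm \<tau> f / 6 \<le> K / 2" using norm by linarith
    then have "\<gamma> * (L1_norm \<tau> g / 3 + L1_norm \<tau> f / 6) \<le> \<gamma> * (K / 2)"
      using ge0 by (rule mult_left_mono)
    then show ?thesis using C by (simp add: field_simps)
  qed
  then have "\<mu>\<^sup>2 * (\<alpha> / 2 + \<gamma> * (L1_norm \<tau> g / 3 + L1_norm \<tau> f / 6)) \<le> \<mu>\<^sup>2 * (C / 2)"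
    by (intro mult_left_mono) auto
  moreover have "\<mu> * N - \<mu>\<^sup>2 * (C / 2) = 1 / C / 2 * N\<^sup>2"
    unfolding \<mu>_def using C by (simp add: field_simps power2_eq_square)
  ultimately have "1 / C / 2 * N\<^sup>2 \<le> (\<integral>\<theta>. R \<theta> \<partial>\<tau>)" by linarith
  \<comment> \<open>\<open>R\<close> may be negative at some points. Passing to its positive part
    only increases the integral and allows the move to \<open>ennreal\<close>.\<close>
  also have "\<dots> \<le> (\<integral>\<theta>. max 0 (R \<theta>) \<partial>\<tau>)"
    using intR by (intro integral_mono) auto
  finally have "ennreal (1 / C / 2 * N\<^sup>2) \<le> ennreal (\<integral>\<theta>. max 0 (R \<theta>) \<partial>\<tau>)"
    by (rule ennreal_leI)
  also have "\<dots> = (\<integral>\<^sup>+\<theta>. ennreal (max 0 (R \<theta>)) \<partial>\<tau>)"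
    using intR by (intro nn_integral_eq_integral[symmetric]) auto
  also have "\<dots> \<le> bregman_int \<tau> I \<eta> f g"
    unfolding bregman_int_def
  proof (rule nn_integral_mono_AE)
    show "AE \<theta> in \<tau>. ennreal (max 0 (R \<theta>)) \<le> e2ennreal (bregman I \<eta> (f \<theta>) (g \<theta>))"
      using pointwise[of \<mu>]
    proof eventually_elim
      case (elim \<theta>)
      then have "e2ennreal (ereal (R \<theta>)) \<le> e2ennreal (bregman I \<eta> (f \<theta>) (g \<theta>))"
        unfolding R_def by (rule e2ennreal_mono)
      then show ?case
        by (simp add: e2ennreal_ereal max_def ennreal_neg split: if_splits)
    qed
  qed
  finally show ?thesis unfolding N_def .
qed

section \<open>Derivatives of the three entropies\<close>

text \<open>Away from 0 the sign is locally constant, so \<open>\<bar>v\<bar>\<close> is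
  \<open>sgn u * v\<close> near \<open>u\<close> and the ordinary power rule applies. The even and
  the odd power are treated together because differentiation exchanges them.\<close>

lemma DERIV_abs_powr:
  fixes u q :: real
  assumes "u \<noteq> 0"
  shows "DERIV (\<lambda>u. \<bar>u\<bar> powr q) u :> q * sgn u * \<bar>u\<bar> powr (q - 1)"
    and "DERIV (\<lambda>u. sgn u * \<bar>u\<bar> powr q) u :> q * \<bar>u\<bar> powr (q - 1)"
proof -
  have s: "\<forall>\<^sub>F v in nhds u. sgn v = sgn u"
  proof (cases "u > 0")
    case True
    then have "\<forall>\<^sub>F v in nhds u. v > 0" using eventually_nhds_in_open[of "{0<..}" u] by simp
    then show ?thesis by eventually_elim (use True in simp)
  next
    case False
    then have "u < 0" using assms by simp
    then have "\<forall>\<^sub>F v in nhds u. v < 0" using eventually_nhds_in_open[of "{..<0}" u] by simp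
    then show ?thesis by eventually_elim (use \<open>u < 0\<close> in simp)
  qed
  have pos: "sgn u * u > 0" using assms by (simp add: sgn_if)
  have sq: "sgn u * sgn u = 1" using assms by (simp add: sgn_if)
  have 0: "DERIV (\<lambda>v. (sgn u * v) powr q) u :> q * sgn u * \<bar>u\<bar> powr (q - 1)"
    using pos by (auto intro!: derivative_eq_intros simp: abs_sgn mult.commute)
  show 1: "DERIV (\<lambda>u. \<bar>u\<bar> powr q) u :> q * sgn u * \<bar>u\<bar> powr (q - 1)"
  proof (rule DERIV_cong_ev[THEN iffD2, OF refl _ refl 0])
    show "\<forall>\<^sub>F v in nhds u. \<bar>v\<bar> powr q = (sgn u * v) powr q"
      using s by eventually_elim (simp add: abs_sgn mult.commute)
  qed
  have 2: "DERIV (\<lambda>v. sgn u * \<bar>v\<bar> powr q) u :> q * \<bar>u\<bar> powr (q - 1)"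
    using DERIV_cmult[OF 1, of "sgn u"] sq by (simp add: mult.left_commute mult.assoc[symmetric])
  show "DERIV (\<lambda>u. sgn u * \<bar>u\<bar> powr q) u :> q * \<bar>u\<bar> powr (q - 1)"
  proof (rule DERIV_cong_ev[THEN iffD2, OF refl _ refl 2])
    show "\<forall>\<^sub>F v in nhds u. sgn v * \<bar>v\<bar> powr q = sgn u * \<bar>v\<bar> powr q"
      using s by eventually_elim simp
  qed
qed

text \<open>Only 0 is critical; there the function is dominated by
  \<open>\<bar>u\<bar> powr q\<close>, which tends to 0 as \<open>q > 0\<close>.\<close>

lemma isCont_sgn_abs_powr:
  fixes u q :: real
  assumes "q > 0"
  shows "isCont (\<lambda>u. sgn u * \<bar>u\<bar> powr q) u"
proof (cases "u = 0")
  case False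
  then show ?thesis using DERIV_abs_powr(2) DERIV_isCont by blast
next
  case True
  have "((\<lambda>u. \<bar>u\<bar> powr q) \<longlongrightarrow> 0) (at (0::real))"
    using assms by (auto intro!: tendsto_eq_intros)
  then have "((\<lambda>u. sgn u * \<bar>u\<bar> powr q) \<longlongrightarrow> 0) (at 0)"
    by (rule Lim_null_comparison[rotated]) (auto simp: abs_mult sgn_if intro!: always_eventually)
  then show ?thesis using True by (simp add: isCont_def)
qed

text \<open>At 0 the difference quotient is an odd power of exponent \<open>p - 1 > 0\<close>, up to
  a constant factor, so it tends to 0.\<close>

lemma DERIV_eta_pow:
  assumes "1 < p"
  shows "DERIV (eta_pow p) u :> sgn u * \<bar>u\<bar> powr (p - 1) / (p - 1)"
proof (cases "u = 0")
  case False
  have "DERIV (\<lambda>u. \<bar>u\<bar> powr p / (p * (p - 1))) u :>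
      p * sgn u * \<bar>u\<bar> powr (p - 1) / (p * (p - 1))"
    by (intro DERIV_cdivide DERIV_abs_powr False)
  then show ?thesis using assms by (simp add: eta_pow_def[abs_def])
next
  case True
  have "((\<lambda>h. sgn h * \<bar>h\<bar> powr (p - 1) / (p * (p - 1))) \<longlongrightarrow> 0) (at 0)"
    using isCont_sgn_abs_powr[of "p - 1" 0] assms
    by (intro tendsto_divide_zero) (auto simp: isCont_def)
  moreover have "\<forall>\<^sub>F h in at 0. sgn h * \<bar>h\<bar> powr (p - 1) / (p * (p - 1))
      = (eta_pow p h - eta_pow p 0) / (h - 0)"
  proof -
    have "sgn h * \<bar>h\<bar> powr (p - 1) = \<bar>h\<bar> powr p / h" if "h \<noteq> 0" for h :: real
      using that by (simp add: powr_diff sgn_if)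
    then show ?thesis
      using assms by (auto simp: eventually_at_filter eta_pow_def intro!: always_eventually)
  qed
  ultimately have "((\<lambda>h. (eta_pow p h - eta_pow p 0) / (h - 0)) \<longlongrightarrow> 0) (at 0)"
    by (rule Lim_transform_eventually)
  then show ?thesis using True by (simp add: has_field_derivative_iff)
qed

lemma DERIV_eta_ent:
  assumes "u > 0"
  shows "DERIV eta_ent u :> ln u"
  unfolding eta_ent_def[abs_def] using assms
  by (auto intro!: derivative_eq_intros)

lemma DERIV_arsinh_scaled:
  assumes "\<beta> > 0"
  shows "DERIV (\<lambda>u. arsinh (u / \<beta>)) u :> 1 / sqrt (u\<^sup>2 + \<beta>\<^sup>2)"
proof -
  have "sqrt ((u / \<beta>)\<^sup>2 + 1) = sqrt ((u\<^sup>2 + \<beta>\<^sup>2) / \<beta>\<^sup>2)"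
    using assms by (simp add: field_simps power2_eq_square)
  also have "\<dots> = sqrt (u\<^sup>2 + \<beta>\<^sup>2) / \<beta>"
    using assms by (simp add: real_sqrt_divide)
  finally have "1 / sqrt ((u / \<beta>)\<^sup>2 + 1) * (1 / \<beta>) = 1 / sqrt (u\<^sup>2 + \<beta>\<^sup>2)"
    using assms by simp
  moreover have "DERIV (\<lambda>u. arsinh (u / \<beta>)) u :> 1 / sqrt ((u / \<beta>)\<^sup>2 + 1) * (1 / \<beta>)"
    by (rule DERIV_chain2[OF arsinh_real_has_field_derivative])
      (use assms in \<open>auto intro!: derivative_eq_intros\<close>)
  ultimately show ?thesis by simp
qed

lemma DERIV_eta_hyp:
  assumes "\<beta> > 0"
  shows "DERIV (eta_hyp \<beta>) u :> arsinh (u / \<beta>)"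
proof -
  have pos: "u\<^sup>2 + \<beta>\<^sup>2 > 0" using assms by (simp add: add_nonneg_pos)
  have "DERIV (\<lambda>u. u\<^sup>2 + \<beta>\<^sup>2) u :> 2 * u" by (auto intro!: derivative_eq_intros)
  from DERIV_chain2[OF DERIV_real_sqrt[OF pos] this]
  have "DERIV (\<lambda>u. sqrt (u\<^sup>2 + \<beta>\<^sup>2)) u :> u * (1 / sqrt (u\<^sup>2 + \<beta>\<^sup>2))"
    by (simp add: field_simps)
  from DERIV_add[OF DERIV_diff[OF DERIV_mult[OF DERIV_ident DERIV_arsinh_scaled[OF assms]] this]
      DERIV_const[of \<beta>]]
  show ?thesis by (simp add: eta_hyp_def[abs_def])
qed

section \<open>Pointwise bounds for the three entropies\<close>

text \<open>For \<open>u > 0\<close> the difference quotient at 0 is \<open>ln u - 1\<close>; the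
  convention 0 log 0 = 0 holds because of the factor 0, giving \<open>eta_ent 0 = 1\<close>.\<close>

lemma ext_deriv_eta_ent_0: "ext_deriv {0..} eta_ent 0 = - \<infinity>"
proof -
  have "filterlim (\<lambda>u::real. ln u - 1) at_bot (at_right 0)"
    using filterlim_tendsto_add_at_bot_iff[of "\<lambda>_. - 1 :: real" "- 1" "at_right 0" ln] ln_at_0
    by simp
  moreover have "\<forall>\<^sub>F u in at_right 0. ln u - 1 = (eta_ent u - eta_ent 0) / (u - 0)"
    by (auto simp: eventually_at_filter eta_ent_def field_simps intro!: always_eventually)
  ultimately have "filterlim (\<lambda>u. (eta_ent u - eta_ent 0) / (u - 0)) at_bot (at_right 0)"
    by (rule filterlim_mono_eventually[OF _ order_refl order_refl])
  then have "((\<lambda>u. ereal ((eta_ent u - eta_ent 0) / (u - 0))) \<longlongrightarrow> - \<infinity>) (at 0 within {0..})"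
    by (simp add: tendsto_MInfty filterlim_at_bot_dense at_within_Ici_at_right)
  then show ?thesis
    unfolding ext_deriv_def by (intro tendsto_Lim) (auto simp: at_within_Ici_at_right)
qed

text \<open>The second derivative is \<open>1 / u\<close>, so the general bound applies with
  \<open>\<alpha> = 0\<close> and \<open>\<gamma> = 1\<close> when both arguments are positive; the
  boundary cases are done by hand.\<close>

lemma bregman_eta_ent_bound:
  assumes "a \<ge> 0" "b \<ge> 0"
  shows "ereal (\<mu> * \<bar>a - b\<bar> - \<mu>\<^sup>2 * (\<bar>b\<bar> / 3 + \<bar>a\<bar> / 6)) \<le> bregman {0..} eta_ent a b"
proof (cases "b = 0")
  case True
  \<comment> \<open>The divergence is infinite for \<open>a > 0\<close>, and for
    \<open>a = 0\<close> both sides are 0.\<close>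
  then show ?thesis
    using assms by (cases "a = 0") (auto simp: bregman_def ext_deriv_eta_ent_0)
next
  case False
  then have b: "b > 0" using assms by simp
  have D: "bregman {0..} eta_ent a b = ereal (eta_ent a - eta_ent b - ln b * (a - b))"
    using b by (intro bregman_DERIV DERIV_eta_ent) (auto simp: interior_real_atLeast)
  show ?thesis
  proof (cases "a = 0")
    case True
    \<comment> \<open>For \<open>a = 0\<close> the divergence is \<open>b\<close>, and the bracket
      is \<open>1 - \<mu> + \<mu>\<^sup>2 / 3\<close> after completing the square.\<close>
    have "0 \<le> b * ((\<mu> - 3 / 2)\<^sup>2 / 3 + 1 / 4)" using b by simp
    also have "\<dots> = b - (\<mu> * b - \<mu>\<^sup>2 * (b / 3))"
      by (simp add: field_simps power2_eq_square)
    finally show ?thesis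
      unfolding D using True b by (simp add: eta_ent_def algebra_simps)
  next
    case False
    then have a: "a > 0" using assms by simp
    have "\<mu> * \<bar>a - b\<bar> - \<mu>\<^sup>2 * (0 / 2 + 1 * (\<bar>b\<bar> / 3 + \<bar>a\<bar> / 6))
        \<le> eta_ent a - eta_ent b - ln b * (a - b)"
      \<comment> \<open>The open half-line is used because the general bound asks for two-sided
        derivatives on all of \<open>I\<close>.\<close>
      by (rule bregman_pointwise_bound[where I = "{0<..}" and \<eta>'' = "\<lambda>u. 1 / u"])
        (use a b in \<open>auto intro!: DERIV_eta_ent DERIV_ln_divide continuous_intros\<close>)
    then show ?thesis unfolding D by simp
  qed
qed

text \<open>The reciprocal of the second derivative,
  \<open>sqrt (u\<^sup>2 + \<beta>\<^sup>2)\<close>, is at most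
  \<open>\<beta> + \<bar>u\<bar>\<close>; this gives \<open>\<alpha> = \<beta>\<close> and
  \<open>\<gamma> = 1\<close>.\<close>

lemma bregman_eta_hyp_bound:
  assumes "\<beta> > 0"
  shows "ereal (\<mu> * \<bar>a - b\<bar> - \<mu>\<^sup>2 * (\<beta> / 2 + 1 * (\<bar>b\<bar> / 3 + \<bar>a\<bar> / 6)))
    \<le> bregman UNIV (eta_hyp \<beta>) a b"
proof -
  have "bregman UNIV (eta_hyp \<beta>) a b = ereal (eta_hyp \<beta> a - eta_hyp \<beta> b - arsinh (b / \<beta>) * (a - b))"
    using assms by (intro bregman_DERIV DERIV_eta_hyp) auto
  moreover have "\<mu> * \<bar>a - b\<bar> - \<mu>\<^sup>2 * (\<beta> / 2 + 1 * (\<bar>b\<bar> / 3 + \<bar>a\<bar> / 6))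
      \<le> eta_hyp \<beta> a - eta_hyp \<beta> b - arsinh (b / \<beta>) * (a - b)"
  proof (rule bregman_pointwise_bound[where I = UNIV and \<eta>'' = "\<lambda>u. 1 / sqrt (u\<^sup>2 + \<beta>\<^sup>2)"])
    show "continuous_on UNIV (\<lambda>u. arsinh (u / \<beta>))"
      using DERIV_arsinh_scaled[OF assms] DERIV_isCont by (blast intro: continuous_at_imp_continuous_on)
    fix u :: real
    have "sqrt (u\<^sup>2 + \<beta>\<^sup>2) \<le> \<beta> + 1 * \<bar>u\<bar>"
      using sqrt_sum_squares_le_sum_abs[of u \<beta>] assms by simp
    moreover have "sqrt (u\<^sup>2 + \<beta>\<^sup>2) > 0" using assms by (simp add: add_nonneg_pos)
    ultimately show "1 / (\<beta> + 1 * \<bar>u\<bar>) \<le> 1 / sqrt (u\<^sup>2 + \<beta>\<^sup>2)"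
      using assms by (intro divide_left_mono mult_pos_pos) auto
  qed (use assms in \<open>auto intro: DERIV_eta_hyp DERIV_arsinh_scaled\<close>)
  ultimately show ?thesis by simp
qed

text \<open>The right-hand side is the tangent at \<open>K\<close> to the concave function
  \<open>u powr s\<close>. The inequality is Young's inequality, or weighted AM-GM, rescaled by
  \<open>K powr (s - 1)\<close>.\<close>

lemma powr_le_tangent:
  fixes K u s :: real
  assumes "K > 0" "u > 0" "0 \<le> s" "s \<le> 1"
  shows "u powr s \<le> (1 - s) * K powr s + s * K powr (s - 1) * u"
proof -
  have "K powr (1 - s) * u powr s \<le> (1 - s) * K + s * u"
    using assms by (intro Youngs_inequality_0) auto
  then have "K powr (s - 1) * (K powr (1 - s) * u powr s) \<le> K powr (s - 1) * ((1 - s) * K + s * u)"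
    by (intro mult_left_mono) auto
  moreover have "K powr (s - 1) * K powr (1 - s) = 1"
    using assms by (simp add: powr_add[symmetric])
  then have "K powr (s - 1) * (K powr (1 - s) * u powr s) = u powr s"
    by (simp add: mult.assoc[symmetric])
  moreover have "K powr (s - 1) * K = K powr s"
    using assms by (simp add: powr_diff)
  then have "K powr (s - 1) * ((1 - s) * K + s * u) = (1 - s) * K powr s + s * K powr (s - 1) * u"
    by (simp add: distrib_left mult.left_commute mult.assoc)
  ultimately show ?thesis by simp
qed

text \<open>The coefficients \<open>\<alpha>\<close> and \<open>\<gamma>\<close> are the intercept
  and the slope of the tangent at \<open>K\<close> to \<open>u powr (2 - p)\<close>, the reciprocal
  of the second derivative for \<open>u > 0\<close>.\<close>

lemma bregman_eta_pow_bound: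
  assumes "1 < p" "p \<le> 2" "K > 0"
  shows "ereal (\<mu> * \<bar>a - b\<bar> - \<mu>\<^sup>2 * ((p - 1) * K powr (2 - p) / 2
      + (2 - p) * K powr (1 - p) * (\<bar>b\<bar> / 3 + \<bar>a\<bar> / 6))) \<le> bregman UNIV (eta_pow p) a b"
proof -
  let ?\<eta>' = "\<lambda>u::real. sgn u * \<bar>u\<bar> powr (p - 1) / (p - 1)"
  have "bregman UNIV (eta_pow p) a b = ereal (eta_pow p a - eta_pow p b - ?\<eta>' b * (a - b))"
    using assms by (intro bregman_DERIV DERIV_eta_pow) auto
  moreover have "\<mu> * \<bar>a - b\<bar> - \<mu>\<^sup>2 * ((p - 1) * K powr (2 - p) / 2
      + (2 - p) * K powr (1 - p) * (\<bar>b\<bar> / 3 + \<bar>a\<bar> / 6)) \<le> eta_pow p a - eta_pow p b - ?\<eta>' b * (a - b)"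
  proof (rule bregman_pointwise_bound[where I = UNIV and \<eta>' = ?\<eta>' and \<eta>'' = "\<lambda>u. \<bar>u\<bar> powr (p - 2)"])
    show "continuous_on UNIV ?\<eta>'"
    proof (intro continuous_at_imp_continuous_on ballI)
      show "isCont ?\<eta>' u" for u
        by (rule isCont_divide[OF isCont_sgn_abs_powr]) (use assms in auto)
    qed
    fix u :: real
    assume u: "u \<noteq> 0"
    show "DERIV ?\<eta>' u :> \<bar>u\<bar> powr (p - 2)"
      using DERIV_cdivide[OF DERIV_abs_powr(2)[OF u, of "p - 1"], of "p - 1"] assms by simp
    show pos: "(p - 1) * K powr (2 - p) + (2 - p) * K powr (1 - p) * \<bar>u\<bar> > 0"
      using assms by (intro add_pos_nonneg) auto
    have "\<bar>u\<bar> powr (2 - p) \<le> (p - 1) * K powr (2 - p) + (2 - p) * K powr (1 - p) * \<bar>u\<bar>"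
      using powr_le_tangent[of K "\<bar>u\<bar>" "2 - p"] assms u by simp
    then have "1 / ((p - 1) * K powr (2 - p) + (2 - p) * K powr (1 - p) * \<bar>u\<bar>) \<le> 1 / \<bar>u\<bar> powr (2 - p)"
      using u pos by (intro divide_left_mono) auto
    also have "\<dots> = \<bar>u\<bar> powr (p - 2)"
      using powr_minus_divide[of "\<bar>u\<bar>" "2 - p"] by simp
    finally show "1 / ((p - 1) * K powr (2 - p) + (2 - p) * K powr (1 - p) * \<bar>u\<bar>) \<le> \<bar>u\<bar> powr (p - 2)" .
  qed (use assms in \<open>auto intro: DERIV_eta_pow\<close>)
  ultimately show ?thesis by simp
qed

section \<open>The three integral inequalities\<close>

theorem lemma3p2:
  fixes \<Theta> :: "'a::t2_space set"
    and \<A> :: "('a, 'n::finite) chart set"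
    and G :: "('a, 'n) metric_tensor"
    and \<tau> :: "'a measure"
    and f g :: "'a \<Rightarrow> real"
    and K :: real
  assumes "compact_riemannian_manifold \<Theta> \<A> G"
    and "normalized_volume \<Theta> \<A> G \<tau>"
    and "K > 0"
    and "integrable \<tau> f" and "integrable \<tau> g"
    and "L1_norm \<tau> f \<le> K" and "L1_norm \<tau> g \<le> K"
  shows "(\<forall>p::real. 1 < p \<and> p \<le> 2 \<longrightarrow>
            bregman_int \<tau> UNIV (eta_pow p) f g
              \<ge> ennreal (K powr (p - 2) / 2 * (L1_norm \<tau> (\<lambda>\<theta>. f \<theta> - g \<theta>))\<^sup>2))
       \<and> ((AE \<theta> in \<tau>. f \<theta> \<ge> 0) \<and> (AE \<theta> in \<tau>. g \<theta> \<ge> 0) \<longrightarrow>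
            bregman_int \<tau> {0..} eta_ent f g
              \<ge> ennreal (K powr (-1) / 2 * (L1_norm \<tau> (\<lambda>\<theta>. f \<theta> - g \<theta>))\<^sup>2))
       \<and> (\<forall>\<beta>::real. \<beta> > 0 \<longrightarrow>
            bregman_int \<tau> UNIV (eta_hyp \<beta>) f g
              \<ge> ennreal ((K + \<beta>) powr (-1) / 2 * (L1_norm \<tau> (\<lambda>\<theta>. f \<theta> - g \<theta>))\<^sup>2))"
proof (intro conjI allI impI)
  have \<tau>: "prob_space \<tau>" using assms(2) by (simp add: normalized_volume_def)
  note lower = bregman_int_lower_bound[OF assms(4,5) \<tau> assms(6,7)]
  show "ennreal (K powr (p - 2) / 2 * (L1_norm \<tau> (\<lambda>\<theta>. f \<theta> - g \<theta>))\<^sup>2)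
      \<le> bregman_int \<tau> UNIV (eta_pow p) f g" if "1 < p \<and> p \<le> 2" for p
  proof -
    \<comment> \<open>The tangent touches the curve at \<open>K\<close>, so
      \<open>\<alpha> + \<gamma> * K\<close> is exactly \<open>K powr (2 - p)\<close>, the
      reciprocal of the factor \<open>K powr (p - 2)\<close> in the claim.\<close>
    have "K powr (1 - p) * K = K powr (2 - p)"
      using \<open>K > 0\<close> powr_add[of K "1 - p" 1] by simp
    then have "(p - 1) * K powr (2 - p) + (2 - p) * K powr (1 - p) * K
        = (p - 1) * K powr (2 - p) + (2 - p) * K powr (2 - p)"
      by (simp add: mult.assoc)
    also have "\<dots> = K powr (2 - p)"
      by (simp add: algebra_simps)
    finally have "(p - 1) * K powr (2 - p) + (2 - p) * K powr (1 - p) * K = K powr (2 - p)" .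
    moreover have "K powr (p - 2) = 1 / K powr (2 - p)"
      using powr_minus_divide[of K "2 - p"] by simp
    ultimately show ?thesis
      using lower[of "(2 - p) * K powr (1 - p)" "(p - 1) * K powr (2 - p)" "K powr (2 - p)"
          UNIV "eta_pow p"]
        that \<open>K > 0\<close> bregman_eta_pow_bound[of p K] by simp
  qed
  show "ennreal (K powr (-1) / 2 * (L1_norm \<tau> (\<lambda>\<theta>. f \<theta> - g \<theta>))\<^sup>2)
      \<le> bregman_int \<tau> {0..} eta_ent f g"
    if "(AE \<theta> in \<tau>. f \<theta> \<ge> 0) \<and> (AE \<theta> in \<tau>. g \<theta> \<ge> 0)"
  proof -
    \<comment> \<open>The terms \<open>0 / 2\<close> and \<open>1 *\<close> are kept so that
      unification reads off \<open>\<alpha> = 0\<close> and \<open>\<gamma> = 1\<close>; the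
      constant \<open>C\<close> is then \<open>K\<close>.\<close>
    have "AE \<theta> in \<tau>. ereal (\<mu> * \<bar>f \<theta> - g \<theta>\<bar> - \<mu>\<^sup>2 * (0 / 2 + 1 * (\<bar>g \<theta>\<bar> / 3 + \<bar>f \<theta>\<bar> / 6)))
        \<le> bregman {0..} eta_ent (f \<theta>) (g \<theta>)" for \<mu>
      using that[THEN conjunct1] that[THEN conjunct2]
      by eventually_elim (use bregman_eta_ent_bound in simp)
    from lower[OF _ _ \<open>K > 0\<close> this] show ?thesis
      using \<open>K > 0\<close> by (simp add: powr_minus_divide)
  qed
  show "ennreal ((K + \<beta>) powr (-1) / 2 * (L1_norm \<tau> (\<lambda>\<theta>. f \<theta> - g \<theta>))\<^sup>2)
      \<le> bregman_int \<tau> UNIV (eta_hyp \<beta>) f g" if "\<beta> > 0" for \<beta>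
    using lower[of 1 \<beta> "K + \<beta>" UNIV "eta_hyp \<beta>"] that \<open>K > 0\<close> bregman_eta_hyp_bound[OF that]
    by (simp add: powr_minus_divide)
qed

end
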